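(* Let $k\ge 0$ be an integer and let $\psi:I\to\mathbb{E}^3$ be a curve parameterized by arc length $s$, with curvature $\kappa(s)\neq 0$ and torsion $\tau(s)\neq 0$ for all $s\in I$. Then $\psi$ is a $k$-slant helix if and only if the vector field $$\mathbf{B}_k=\frac{\psi_{k+1}\times\psi_{k+2}}{\|\psi_{k+1}\times\psi_{k+2}\|}$$ makes a constant angle with a fixed direction.
   Context: $\mathbb{E}^3$ is Euclidean 3-space, $I\subset\mathbb{R}$ is an open interval, and $'$ denotes $d/ds$. The curve is assumed sufficiently differentiable (e.g. of class $C^{k+3}$) for all objects to exist; the curvature satisfies $\kappa>0$. Define $\psi_0=\psi$ and recursively $\psi_{j+1}(s)=\psi_j'(s)/\|\psi_j'(s)\|$ for $j\ge 0$ (so $\psi_1$ is the unit tangent and $\psi_2$ the principal normal of $\psi$). A unit vector field $v(s)$ makes a constant angle with a fixed direction if there is a constant unit vector $\mathbf{d}$ such that $\langle v(s),\mathbf{d}\rangle$ is constant on $I$. The curve $\psi$ is called a $k$-slant helix if $\psi_{k+1}$ makes a constant angle with a fixed direction. *)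

theory Defs
  imports "HOL-Analysis.Analysis"
begin

text \<open>
  Curves are total functions on the reals, studied on an open interval I. Derivatives are taken
  at points of the open set I, so values outside I are irrelevant.
\<close>

definition velocity :: "(real \<Rightarrow> 'a::real_normed_vector) \<Rightarrow> real \<Rightarrow> 'a"
  where "velocity f = (\<lambda>s. vector_derivative f (at s))"

text \<open>Class C^n on a set, meaningful for open I.\<close>

primrec Ck_on :: "nat \<Rightarrow> (real \<Rightarrow> 'a::real_normed_vector) \<Rightarrow> real set \<Rightarrow> bool"
  where
    "Ck_on 0 f I \<longleftrightarrow> continuous_on I f"
  | "Ck_on (Suc n) f I \<longleftrightarrow> f differentiable_on I \<and> Ck_on n (velocity f) I"

primrec psi_seq :: "(real \<Rightarrow> real^3) \<Rightarrow> nat \<Rightarrow> real \<Rightarrow> real^3"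
  where
    "psi_seq \<psi> 0 = \<psi>"
  | "psi_seq \<psi> (Suc j) =
       (\<lambda>s. velocity (psi_seq \<psi> j) s /\<^sub>R norm (velocity (psi_seq \<psi> j) s))"

definition B_field :: "(real \<Rightarrow> real^3) \<Rightarrow> nat \<Rightarrow> real \<Rightarrow> real^3"
  where "B_field \<psi> k =
    (\<lambda>s. cross3 (psi_seq \<psi> (k + 1) s) (psi_seq \<psi> (k + 2) s)
          /\<^sub>R norm (cross3 (psi_seq \<psi> (k + 1) s) (psi_seq \<psi> (k + 2) s)))"

definition arc_length_param_on :: "(real \<Rightarrow> real^3) \<Rightarrow> real set \<Rightarrow> bool"
  where "arc_length_param_on \<psi> I \<longleftrightarrow> (\<forall>s\<in>I. norm (velocity \<psi> s) = 1)"

text \<open>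
  Curvature and torsion of a curve parameterized by arc length, read off from the Frenet
  equations T' = \<kappa> N and B' = - \<tau> N, where T = psi_seq \<psi> 1, N = psi_seq \<psi> 2 and
  B = T \<times> N.
\<close>

definition curvature :: "(real \<Rightarrow> real^3) \<Rightarrow> real \<Rightarrow> real"
  where "curvature \<psi> s = norm (velocity (psi_seq \<psi> 1) s)"

definition torsion :: "(real \<Rightarrow> real^3) \<Rightarrow> real \<Rightarrow> real"
  where "torsion \<psi> s =
    - (velocity (\<lambda>t. cross3 (psi_seq \<psi> 1 t) (psi_seq \<psi> 2 t)) s \<bullet> psi_seq \<psi> 2 s)"

text \<open>Applied below to unit vector fields only. The direction d may depend on the field v.\<close>

definition constant_angle_on :: "(real \<Rightarrow> real^3) \<Rightarrow> real set \<Rightarrow> bool"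
  where "constant_angle_on v I \<longleftrightarrow>
    (\<exists>d. norm d = 1 \<and> (\<lambda>s. v s \<bullet> d) constant_on I)"

definition k_slant_helix :: "nat \<Rightarrow> (real \<Rightarrow> real^3) \<Rightarrow> real set \<Rightarrow> bool"
  where "k_slant_helix k \<psi> I \<longleftrightarrow> constant_angle_on (psi_seq \<psi> (k + 1)) I"

end

theory Submission
  imports Defs
begin

text \<open>
  Write \<open>v = \<psi>\<^bsub>k+1\<^esub>\<close>, \<open>w = \<psi>\<^bsub>k+2\<^esub>\<close> and \<open>b = v \<times> w\<close>. Consecutive fields of the sequence are
  orthonormal, so \<open>b\<close> is the field of the theorem and \<open>v, w, b\<close> is an orthonormal frame. It obeys
  equations of Frenet type \<open>v' = f w\<close>, \<open>w' = - f v + g b\<close>, \<open>b' = - g w\<close>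
  with \<open>f = \<parallel>v'\<parallel> > 0\<close> and \<open>f, g\<close> continuous. (That the fields are defined and regular enough follows
  from \<open>\<psi>\<^bsub>j+1\<^esub>' \<bullet> \<psi>\<^bsub>j\<^esub> = - \<parallel>\<psi>\<^bsub>j\<^esub>'\<parallel>\<close>: once one derivative in the sequence has no zero, neither do
  the later ones.)

  If \<open>v \<bullet> d\<close> is constant, then \<open>f (w \<bullet> d) = 0\<close>, hence \<open>w \<bullet> d = 0\<close>, and \<open>b \<bullet> d\<close> has derivative
  \<open>- g (w \<bullet> d) = 0\<close>.

  The converse is less immediate for \<open>k \<ge> 1\<close>, because \<open>g\<close> may have zeros and \<open>b \<bullet> d = c\<close> only gives
  \<open>g (w \<bullet> d) = 0\<close>. The way out is that \<open>g\<close> vanishes identically or nowhere, unless \<open>d = \<plusminus>b\<close>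
  throughout. On the open set where \<open>g \<noteq> 0\<close> the function \<open>w \<bullet> d\<close> vanishes together with its
  derivative, so \<open>f (v \<bullet> d) = g c\<close> and \<open>(v \<bullet> d)\<^sup>2 = 1 - c\<^sup>2\<close>; this pins the ratio \<open>g\<^sup>2 / f\<^sup>2\<close> to a constant.
  By continuity \<open>g\<close> cannot tend to zero at a boundary point of this set, and connectedness of the
  interval decides. If \<open>g\<close> has no zero, then \<open>w \<bullet> d = 0\<close> and \<open>v \<bullet> d\<close> is constant; if \<open>g\<close> vanishes
  identically, then \<open>b\<close> is a constant vector and \<open>v \<bullet> b = 0\<close>, so the direction \<open>d\<close> is replaced by \<open>b\<close>.
  In the exceptional case \<open>d = \<plusminus>b\<close> already \<open>v \<bullet> d = 0\<close>. The lemma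
  \<open>g_vanishes_everywhere_or_nowhere\<close> carries this dichotomy.
\<close>

section \<open>Calculus of functions of class \<open>C\<^sup>n\<close> on an open set\<close>

lemma has_vector_derivative_velocity:
  assumes "open I" "f differentiable_on I" "s \<in> I"
  shows "(f has_vector_derivative velocity f s) (at s)"
  using assms by (simp add: velocity_def differentiable_on_eq_differentiable_at
      vector_derivative_works[symmetric])

lemma velocity_eqI: "(f has_vector_derivative f') (at s) \<Longrightarrow> velocity f s = f'"
  by (simp add: velocity_def vector_derivative_at)

lemma velocity_cong:
  assumes "open I" "s \<in> I" "\<And>t. t \<in> I \<Longrightarrow> f t = g t"
  shows "velocity f s = velocity g s"
  unfolding velocity_def
  using assms by (intro vector_derivative_cong_eq) (auto simp: eventually_nhds)

lemma Ck_on_cong: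
  assumes "open I" "\<And>s. s \<in> I \<Longrightarrow> f s = g s" "Ck_on n f I"
  shows "Ck_on n g I"
  using assms(2,3)
proof (induction n arbitrary: f g)
  case 0
  then show ?case using continuous_on_cong[of I I f g] by simp
next
  case (Suc n)
  have "g differentiable_on I"
    using Suc.prems by (auto simp: differentiable_on_def
        intro: differentiable_transform_within[OF _ zero_less_one])
  moreover have "Ck_on n (velocity g) I"
    using Suc.IH[of "velocity f" "velocity g"] Suc.prems velocity_cong[OF assms(1)] by auto
  ultimately show ?case by simp
qed

lemma Ck_on_SucI:
  assumes "open I" "\<And>s. s \<in> I \<Longrightarrow> (f has_vector_derivative f' s) (at s)" "Ck_on n f' I"
  shows "Ck_on (Suc n) f I"
proof -
  have "f differentiable_on I"
    using assms(1,2) by (auto simp: differentiable_on_eq_differentiable_at intro: differentiableI_vector)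
  moreover have "Ck_on n (velocity f) I"
    using Ck_on_cong[OF assms(1) _ assms(3)] velocity_eqI[OF assms(2)] by auto
  ultimately show ?thesis by simp
qed

lemma Ck_on_Suc_imp_Ck_on: "Ck_on (Suc n) f I \<Longrightarrow> Ck_on n f I"
  by (induction n arbitrary: f) (auto intro: differentiable_imp_continuous_on)

lemma Ck_on_const:
  assumes "open I"
  shows "Ck_on n (\<lambda>_. c) I"
proof (induction n arbitrary: c)
  case (Suc n)
  show ?case by (rule Ck_on_SucI[OF assms _ Suc.IH[of 0]]) auto
qed simp

lemma Ck_on_add:
  assumes "open I" "Ck_on n f I" "Ck_on n g I"
  shows "Ck_on n (\<lambda>s. f s + g s) I"
  using assms(2,3)
proof (induction n arbitrary: f g)
  case 0
  then show ?case by (simp add: continuous_on_add)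
next
  case (Suc n)
  then show ?case
    by (intro Ck_on_SucI[where f' = "\<lambda>s. velocity f s + velocity g s"]
        has_vector_derivative_add has_vector_derivative_velocity) (auto intro: assms(1))
qed

lemma (in bounded_bilinear) Ck_on:
  assumes "open I" "Ck_on n f I" "Ck_on n g I"
  shows "Ck_on n (\<lambda>s. prod (f s) (g s)) I"
  using assms(2,3)
proof (induction n arbitrary: f g)
  case 0
  then show ?case by (simp add: continuous_on)
next
  case (Suc n)
  then have "Ck_on n f I" "Ck_on n g I"
    by (auto intro: Ck_on_Suc_imp_Ck_on simp del: Ck_on.simps)
  then have "Ck_on n (\<lambda>s. prod (f s) (velocity g s) + prod (velocity f s) (g s)) I"
    using Suc by (intro Ck_on_add[OF assms(1)] Suc.IH) auto
  moreover have "((\<lambda>s. prod (f s) (g s)) has_vector_derivative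
      prod (f s) (velocity g s) + prod (velocity f s) (g s)) (at s)" if "s \<in> I" for s
    using Suc.prems that
    by (intro has_vector_derivative has_vector_derivative_velocity[OF assms(1)]) auto
  ultimately show ?case
    by (intro Ck_on_SucI[OF assms(1)])
qed

text \<open>
  The derivative of \<open>u = 1 / \<parallel>f\<parallel>\<close> is \<open>- (f \<bullet> f') u\<^sup>3\<close>, a product of \<open>f\<close>, \<open>f'\<close> and \<open>u\<close> itself; this
  closes the induction on the order of differentiability.
\<close>

lemma Ck_on_inverse_norm:
  fixes f :: "real \<Rightarrow> 'a::real_inner"
  assumes "open I" "Ck_on n f I" and nz: "\<And>s. s \<in> I \<Longrightarrow> f s \<noteq> 0"
  shows "Ck_on n (\<lambda>s. inverse (norm (f s))) I"
  using assms(2)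
proof (induction n)
  case 0
  then show ?case using nz by (auto intro!: continuous_intros)
next
  case (Suc n)
  let ?u = "\<lambda>s. inverse (norm (f s))"
  have f: "Ck_on n f I" and f': "Ck_on n (velocity f) I" and fd: "f differentiable_on I"
    using Suc.prems by (auto intro: Ck_on_Suc_imp_Ck_on simp del: Ck_on.simps simp: Ck_on.simps(2)[of n])
  have u: "Ck_on n ?u I"
    using Suc.IH f by simp
  note mult = bounded_bilinear.Ck_on[OF bounded_bilinear_mult assms(1)]
  have "Ck_on n (\<lambda>s. (f s \<bullet> velocity f s) * (?u s * (?u s * ?u s))) I"
    by (intro mult bounded_bilinear.Ck_on[OF bounded_bilinear_inner assms(1)] f f' u)
  from mult[OF Ck_on_const[OF assms(1), of n "-1"] this]
  have "Ck_on n (\<lambda>s. - ((f s \<bullet> velocity f s) * (?u s * (?u s * ?u s)))) I"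
    by simp
  moreover have "(?u has_vector_derivative - ((f s \<bullet> velocity f s) * (?u s * (?u s * ?u s)))) (at s)"
    if "s \<in> I" for s
  proof -
    have "((\<lambda>s. f s \<bullet> f s) has_vector_derivative f s \<bullet> velocity f s + velocity f s \<bullet> f s) (at s)"
      by (intro bounded_bilinear.has_vector_derivative[OF bounded_bilinear_inner]
          has_vector_derivative_velocity[OF assms(1) fd that])
    then have "((\<lambda>s. f s \<bullet> f s) has_real_derivative 2 * (f s \<bullet> velocity f s)) (at s)"
      by (simp add: has_real_derivative_iff_has_vector_derivative inner_commute)
    then have "((\<lambda>s. inverse (sqrt (f s \<bullet> f s))) has_real_derivative
        - ((f s \<bullet> velocity f s) * (?u s * (?u s * ?u s)))) (at s)"
      using nz[OF that] inner_ge_zero[THEN leD, of "f s"]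
      by (auto intro!: derivative_eq_intros simp: norm_eq_sqrt_inner)
    then show ?thesis
      by (simp add: has_real_derivative_iff_has_vector_derivative norm_eq_sqrt_inner)
  qed
  ultimately show ?case
    by (intro Ck_on_SucI[OF assms(1)])
qed

lemma Ck_on_normalize:
  fixes f :: "real \<Rightarrow> 'a::real_inner"
  assumes "open I" "Ck_on n f I" "\<And>s. s \<in> I \<Longrightarrow> f s \<noteq> 0"
  shows "Ck_on n (\<lambda>s. f s /\<^sub>R norm (f s)) I"
  by (intro bounded_bilinear.Ck_on[OF bounded_bilinear_scaleR assms(1)] Ck_on_inverse_norm assms)

lemma constant_on_if_vanishing_vector_derivative:
  assumes "is_interval I" "\<And>s. s \<in> I \<Longrightarrow> (f has_vector_derivative 0) (at s)"
  shows "f constant_on I"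
proof -
  have "convex I"
    using assms(1) by (rule is_interval_convex)
  then obtain c where "\<And>s. s \<in> I \<Longrightarrow> f s = c"
    by (rule has_vector_derivative_zero_constant) (auto intro: has_vector_derivative_at_within assms(2))
  then show ?thesis
    by (auto simp: constant_on_def)
qed

lemma vector_derivative_eq_0_if_constant_on:
  assumes "open I" "f constant_on I" "s \<in> I" "(f has_vector_derivative f') (at s)"
  shows "f' = 0"
proof -
  obtain c where "\<And>t. t \<in> I \<Longrightarrow> f t = c"
    using assms(2) by (auto simp: constant_on_def)
  then have "((\<lambda>_. c) has_vector_derivative f') (at s)"
    using has_vector_derivative_transform_within_open[OF assms(4,1,3)] by simp
  then show ?thesis
    using vector_derivative_unique_at has_vector_derivative_const by blast
qed

section \<open>Orthonormal frames\<close>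

lemma norm_cross3_orthonormal:
  assumes "norm v = 1" "norm w = 1" "v \<bullet> w = 0"
  shows "norm (cross3 v w) = 1"
  using norm_cross_dot[of v w] assms by (simp add: power2_eq_1_iff)
    (smt (verit) norm_ge_zero)

text \<open>
  The residual \<open>y\<close> of the expansion is orthogonal to all three frame vectors, so its inner and
  cross product with \<open>v \<times> w\<close> both vanish.
\<close>

lemma orthonormal_frame_expansion:
  assumes "norm v = 1" "norm w = 1" "v \<bullet> w = 0"
  shows "x = (x \<bullet> v) *\<^sub>R v + (x \<bullet> w) *\<^sub>R w + (x \<bullet> cross3 v w) *\<^sub>R cross3 v w"
proof -
  define b where "b = cross3 v w"
  define y where "y = x - ((x \<bullet> v) *\<^sub>R v + (x \<bullet> w) *\<^sub>R w + (x \<bullet> b) *\<^sub>R b)"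
  have b: "norm b = 1" "v \<bullet> b = 0" "w \<bullet> b = 0" "b \<bullet> v = 0" "b \<bullet> w = 0"
    unfolding b_def using norm_cross3_orthonormal[OF assms]
    by (simp_all add: dot_cross_self cross3_simps)
  have "w \<bullet> v = 0"
    using assms(3) by (simp add: inner_commute)
  then have "y \<bullet> v = 0" "y \<bullet> w = 0" "y \<bullet> b = 0"
    using assms b unfolding y_def
    by (simp_all add: inner_diff_left inner_add_left norm_eq_1)
  moreover have "cross3 y b = (y \<bullet> w) *\<^sub>R v - (y \<bullet> v) *\<^sub>R w"
    unfolding b_def by (rule Lagrange)
  ultimately have "y = 0 \<or> b = 0"
    using norm_and_cross_eq_0[of y b] by simp
  then show ?thesis
    using b(1) by (auto simp: y_def b_def)
qed

lemma orthonormal_frame_Parseval: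
  assumes "norm v = 1" "norm w = 1" "v \<bullet> w = 0"
  shows "(v \<bullet> x)\<^sup>2 + (w \<bullet> x)\<^sup>2 + (cross3 v w \<bullet> x)\<^sup>2 = (norm x)\<^sup>2"
proof -
  have "x \<bullet> x = ((x \<bullet> v) *\<^sub>R v + (x \<bullet> w) *\<^sub>R w + (x \<bullet> cross3 v w) *\<^sub>R cross3 v w) \<bullet> x"
    using orthonormal_frame_expansion[OF assms, of x] by simp
  then show ?thesis
    by (simp add: inner_add_right power2_eq_square inner_commute dot_square_norm)
qed

lemma inner_velocity_unit_field:
  assumes "open I" "\<And>t. t \<in> I \<Longrightarrow> norm (v t) = 1" "s \<in> I" "(v has_vector_derivative v') (at s)"
  shows "v s \<bullet> v' = 0"
proof -
  have "((\<lambda>t. v t \<bullet> v t) has_vector_derivative v s \<bullet> v' + v' \<bullet> v s) (at s)"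
    by (intro bounded_bilinear.has_vector_derivative[OF bounded_bilinear_inner] assms(4))
  moreover have "(\<lambda>t. v t \<bullet> v t) constant_on I"
    using assms(2) by (auto simp: constant_on_def norm_eq_1)
  ultimately show ?thesis
    using vector_derivative_eq_0_if_constant_on[OF assms(1) _ assms(3)] by (fastforce simp: inner_commute)
qed

lemma inner_velocity_orthogonal_fields:
  assumes "open I" "\<And>t. t \<in> I \<Longrightarrow> v t \<bullet> w t = 0" "s \<in> I"
    and "(v has_vector_derivative v') (at s)" "(w has_vector_derivative w') (at s)"
  shows "w' \<bullet> v s = - (v' \<bullet> w s)"
proof -
  have "((\<lambda>t. v t \<bullet> w t) has_vector_derivative v s \<bullet> w' + v' \<bullet> w s) (at s)"
    by (intro bounded_bilinear.has_vector_derivative[OF bounded_bilinear_inner] assms(4,5))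
  moreover have "(\<lambda>t. v t \<bullet> w t) constant_on I"
    using assms(2) by (auto simp: constant_on_def)
  ultimately have "v s \<bullet> w' + v' \<bullet> w s = 0"
    using vector_derivative_eq_0_if_constant_on[OF assms(1) _ assms(3)] by blast
  then show ?thesis
    by (simp add: inner_commute)
qed

text \<open>
  The equivalence concerns only two consecutive fields of the sequence, so it is proved for a unit
  field \<open>v\<close> and its unit direction of change \<open>w\<close>, without a curve. Continuity of \<open>f\<close> and of \<open>w'\<close> is what
  the limit argument for the zeros of \<open>g\<close> consumes.
\<close>

locale moving_frame =
  fixes I :: "real set" and v w w' :: "real \<Rightarrow> real^3" and f :: "real \<Rightarrow> real"
  assumes open_I: "open I" and interval_I: "is_interval I"
    and norm_v: "\<And>s. s \<in> I \<Longrightarrow> norm (v s) = 1"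
    and norm_w: "\<And>s. s \<in> I \<Longrightarrow> norm (w s) = 1"
    and deriv_v: "\<And>s. s \<in> I \<Longrightarrow> (v has_vector_derivative f s *\<^sub>R w s) (at s)"
    and deriv_w: "\<And>s. s \<in> I \<Longrightarrow> (w has_vector_derivative w' s) (at s)"
    and f_nonzero: "\<And>s. s \<in> I \<Longrightarrow> f s \<noteq> 0"
    and continuous_f: "continuous_on I f"
    and continuous_w': "continuous_on I w'"
begin

definition b :: "real \<Rightarrow> real^3" where "b s = cross3 (v s) (w s)"
definition g :: "real \<Rightarrow> real" where "g s = w' s \<bullet> b s"

lemma v_orthogonal_w: "s \<in> I \<Longrightarrow> v s \<bullet> w s = 0"
  using inner_velocity_unit_field[OF open_I norm_v _ deriv_v] f_nonzero by auto

lemma norm_b: "s \<in> I \<Longrightarrow> norm (b s) = 1"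
  unfolding b_def by (intro norm_cross3_orthonormal norm_v norm_w v_orthogonal_w)

lemma w'_eq: 
  assumes "s \<in> I"
  shows "w' s = g s *\<^sub>R b s - f s *\<^sub>R v s"
proof -
  have "w' s \<bullet> w s = 0"
    using inner_velocity_unit_field[OF open_I norm_w assms deriv_w[OF assms]]
    by (simp add: inner_commute)
  moreover have "w' s \<bullet> v s = - f s"
    using inner_velocity_orthogonal_fields[OF open_I v_orthogonal_w assms deriv_v deriv_w] assms
      norm_w[OF assms] by (simp add: norm_eq_1)
  ultimately show ?thesis
    using orthonormal_frame_expansion[OF norm_v norm_w v_orthogonal_w, of s "w' s"] assms
    by (simp add: b_def g_def)
qed

lemma deriv_b:
  assumes "s \<in> I"
  shows "(b has_vector_derivative - g s *\<^sub>R w s) (at s)"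
proof -
  have "bounded_bilinear cross3"
    using bilinear_cross bilinear_conv_bounded_bilinear by blast
  then have "(b has_vector_derivative cross3 (v s) (w' s) + cross3 (f s *\<^sub>R w s) (w s)) (at s)"
    unfolding b_def
    by (rule bounded_bilinear.has_vector_derivative[OF _ deriv_v[OF assms] deriv_w[OF assms]])
  moreover have "cross3 (v s) (b s) = - w s"
    using Lagrange[of "v s" "v s" "w s"] norm_v[OF assms] v_orthogonal_w[OF assms]
    by (simp add: b_def norm_eq_1)
  ultimately show ?thesis
    by (simp add: w'_eq[OF assms] cross_mult_left cross_mult_right Cross3.right_diff_distrib)
qed

lemma continuous_g: "continuous_on I g"
proof -
  have "continuous_on I v" "continuous_on I w"
    using deriv_v deriv_w
    by (auto intro!: continuous_at_imp_continuous_on has_vector_derivative_continuous)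
  then show ?thesis
    unfolding g_def b_def by (intro continuous_on_inner continuous_w' continuous_on_cross)
qed

lemma deriv_inner_v: "s \<in> I \<Longrightarrow> ((\<lambda>s. v s \<bullet> d) has_vector_derivative f s * (w s \<bullet> d)) (at s)"
  using bounded_linear.has_vector_derivative[OF bounded_linear_inner_left deriv_v] by force

lemma deriv_inner_w:
  "s \<in> I \<Longrightarrow> ((\<lambda>s. w s \<bullet> d) has_vector_derivative g s * (b s \<bullet> d) - f s * (v s \<bullet> d)) (at s)"
  using bounded_linear.has_vector_derivative[OF bounded_linear_inner_left deriv_w]
  by (force simp: w'_eq inner_diff_left)

lemma deriv_inner_b: "s \<in> I \<Longrightarrow> ((\<lambda>s. b s \<bullet> d) has_vector_derivative - g s * (w s \<bullet> d)) (at s)"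
  using bounded_linear.has_vector_derivative[OF bounded_linear_inner_left deriv_b] by force

lemma inner_v_constant_if_w_orthogonal:
  assumes "\<And>s. s \<in> I \<Longrightarrow> w s \<bullet> d = 0"
  shows "(\<lambda>s. v s \<bullet> d) constant_on I"
  by (rule constant_on_if_vanishing_vector_derivative[OF interval_I])
    (use deriv_inner_v[of _ d] assms in auto)

lemma constant_angle_v_imp_b:
  assumes "constant_angle_on v I"
  shows "constant_angle_on b I"
proof -
  obtain d where d: "norm d = 1" "(\<lambda>s. v s \<bullet> d) constant_on I"
    using assms by (auto simp: constant_angle_on_def)
  have "w s \<bullet> d = 0" if "s \<in> I" for s
    using vector_derivative_eq_0_if_constant_on[OF open_I d(2) that deriv_inner_v[OF that]]
      f_nonzero[OF that] by simp
  then have "(\<lambda>s. b s \<bullet> d) constant_on I"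
    by (intro constant_on_if_vanishing_vector_derivative[OF interval_I])
      (use deriv_inner_b[of _ d] in auto)
  then show ?thesis
    using d(1) by (auto simp: constant_angle_on_def)
qed

text \<open>
  Where \<open>g\<close> is nonzero, both \<open>w \<bullet> d\<close> and its derivative vanish. This ties \<open>g\<close> to \<open>f\<close> by an equation with
  constant coefficients, which survives in the limit.
\<close>

lemma g_vanishes_everywhere_or_nowhere:
  assumes d: "norm d = 1" and c: "\<And>s. s \<in> I \<Longrightarrow> b s \<bullet> d = c" and c2: "c\<^sup>2 \<noteq> 1"
  shows "(\<forall>s\<in>I. g s = 0) \<or> (\<forall>s\<in>I. g s \<noteq> 0)"
proof -
  define A where "A = {s \<in> I. g s \<noteq> 0}"
  have open_A: "open A"
    using continuous_open_preimage[OF continuous_g open_I, of "- {0}"]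
    by (simp add: A_def vimage_def Int_def open_Compl)
  have wd: "w s \<bullet> d = 0" if "s \<in> A" for s
  proof -
    have "(\<lambda>s. b s \<bullet> d) constant_on I"
      using c by (auto simp: constant_on_def)
    then have "- g s * (w s \<bullet> d) = 0"
      using vector_derivative_eq_0_if_constant_on[OF open_I] deriv_inner_b that
      unfolding A_def by blast
    then show ?thesis
      using that by (simp add: A_def)
  qed
  \<comment> \<open>The right-hand side is closed relative to \<open>I\<close>.\<close>
  have "A = {s \<in> I. (f s)\<^sup>2 * (1 - c\<^sup>2) - (g s)\<^sup>2 * c\<^sup>2 = 0}"
  proof (intro set_eqI iffI)
    fix s assume s: "s \<in> A"
    then have sI: "s \<in> I" by (simp add: A_def)
    have "(\<lambda>s. w s \<bullet> d) constant_on A"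
      using wd by (auto simp: constant_on_def)
    then have "g s * c = f s * (v s \<bullet> d)"
      using vector_derivative_eq_0_if_constant_on[OF open_A _ s deriv_inner_w[OF sI]] c[OF sI]
      by fastforce
    then have "(g s)\<^sup>2 * c\<^sup>2 = (f s)\<^sup>2 * (v s \<bullet> d)\<^sup>2"
      by (metis power_mult_distrib)
    moreover have "(v s \<bullet> d)\<^sup>2 = 1 - c\<^sup>2"
      using orthonormal_frame_Parseval[OF norm_v norm_w v_orthogonal_w, OF sI sI sI, of d]
        wd[OF s] c[OF sI] d by (simp add: b_def)
    ultimately show "s \<in> {s \<in> I. (f s)\<^sup>2 * (1 - c\<^sup>2) - (g s)\<^sup>2 * c\<^sup>2 = 0}"
      using sI by simp
  next
    fix s assume "s \<in> {s \<in> I. (f s)\<^sup>2 * (1 - c\<^sup>2) - (g s)\<^sup>2 * c\<^sup>2 = 0}"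
    then show "s \<in> A"
      using f_nonzero c2 by (auto simp: A_def)
  qed
  moreover have "continuous_on I (\<lambda>s. (f s)\<^sup>2 * (1 - c\<^sup>2) - (g s)\<^sup>2 * c\<^sup>2)"
    by (intro continuous_intros continuous_f continuous_g)
  ultimately have "closedin (top_of_set I) A"
    using continuous_closedin_preimage_constant by fastforce
  moreover have "openin (top_of_set I) A"
    using open_A open_I by (auto simp: openin_open_eq A_def)
  moreover have "connected I"
    using interval_I by (rule is_interval_connected)
  ultimately have "A = {} \<or> A = I"
    using connected_clopen by blast
  then show ?thesis
    by (auto simp: A_def)
qed

lemma constant_angle_b_imp_v:
  assumes "constant_angle_on b I"
  shows "constant_angle_on v I"
proof -
  obtain d c where d: "norm d = 1" and c: "\<And>s. s \<in> I \<Longrightarrow> b s \<bullet> d = c"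
    using assms by (auto simp: constant_angle_on_def constant_on_def)
  have Parseval: "(v s \<bullet> d)\<^sup>2 + (w s \<bullet> d)\<^sup>2 + c\<^sup>2 = 1" if "s \<in> I" for s
    using orthonormal_frame_Parseval[OF norm_v norm_w v_orthogonal_w, OF that that that, of d]
      c[OF that] d by (simp add: b_def)
  consider "\<forall>s\<in>I. w s \<bullet> d = 0" | "I \<noteq> {}" "\<forall>s\<in>I. g s = 0"
  proof (cases "c\<^sup>2 = 1")
    \<comment> \<open>Here \<open>b\<close> is \<open>d\<close> or \<open>- d\<close>, so \<open>w\<close> is orthogonal to \<open>d\<close>.\<close>
    case True
    then show ?thesis
      using Parseval that(1) by (auto simp: add_nonneg_eq_0_iff)
  next
    case False
    have "w s \<bullet> d = 0" if "s \<in> I" "g s \<noteq> 0" for s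
    proof -
      have "(\<lambda>s. b s \<bullet> d) constant_on I"
        using c by (auto simp: constant_on_def)
      then show ?thesis
        using vector_derivative_eq_0_if_constant_on[OF open_I _ that(1) deriv_inner_b[OF that(1)]]
          that(2) by fastforce
    qed
    then show ?thesis
      using g_vanishes_everywhere_or_nowhere[OF d c False] that by blast
  qed
  then show ?thesis
  proof cases
    case 1
    then show ?thesis
      using inner_v_constant_if_w_orthogonal d by (auto simp: constant_angle_on_def)
  next
    case 2
    \<comment> \<open>Now \<open>d\<close> need not work for \<open>v\<close>, which moves in the plane orthogonal to the constant vector \<open>b\<close>.\<close>
    then obtain s0 where s0: "s0 \<in> I" by blast
    have "b constant_on I"
      by (rule constant_on_if_vanishing_vector_derivative[OF interval_I])
        (use deriv_b 2(2) in force)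
    then have "b s = b s0" if "s \<in> I" for s
      using that s0 by (auto simp: constant_on_def)
    then have "v s \<bullet> b s0 = 0" if "s \<in> I" for s
      using that dot_cross_self(1)[of "v s" "w s"] by (metis b_def)
    then show ?thesis
      using norm_b[OF s0] by (auto simp: constant_angle_on_def constant_on_def)
  qed
qed

end

section \<open>The sequence of successive unit tangents\<close>

text \<open>
  Each step costs one derivative. Nonvanishing propagates: differentiating \<open>\<psi>\<^bsub>j\<^esub> \<bullet> \<psi>\<^bsub>j+1\<^esub> = 0\<close> gives
  \<open>\<psi>\<^bsub>j+1\<^esub>' \<bullet> \<psi>\<^bsub>j\<^esub> = - \<parallel>\<psi>\<^bsub>j\<^esub>'\<parallel> \<noteq> 0\<close>. The induction starts at \<open>\<psi>\<^bsub>1\<^esub>\<close>, whose derivative has the curvature as its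
  norm.
\<close>

lemma psi_seq_regular:
  assumes I: "open I" and "Ck_on (m + Suc (Suc j)) \<psi> I" "arc_length_param_on \<psi> I"
    and \<kappa>: "\<And>s. s \<in> I \<Longrightarrow> curvature \<psi> s \<noteq> 0"
  shows "Ck_on (Suc m) (psi_seq \<psi> (Suc j)) I \<and>
    (\<forall>s\<in>I. norm (psi_seq \<psi> (Suc j) s) = 1 \<and> velocity (psi_seq \<psi> (Suc j)) s \<noteq> 0)"
  using assms(2)
proof (induction j arbitrary: m)
  case 0
  have nz: "\<And>s. s \<in> I \<Longrightarrow> velocity \<psi> s \<noteq> 0"
    using assms(3) by (force simp: arc_length_param_on_def)
  have "Ck_on (Suc m) (velocity \<psi>) I"
    using 0 by simp
  then have "Ck_on (Suc m) (psi_seq \<psi> 1) I"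
    using Ck_on_normalize[OF I _ nz] by (simp del: Ck_on.simps)
  moreover have "velocity (psi_seq \<psi> 1) s \<noteq> 0" if "s \<in> I" for s
    using \<kappa>[OF that] by (simp add: curvature_def)
  ultimately show ?case
    using nz by (simp del: Ck_on.simps)
next
  case (Suc j)
  define v where "v = psi_seq \<psi> (Suc j)"
  define w where "w = psi_seq \<psi> (Suc (Suc j))"
  have w: "w s = velocity v s /\<^sub>R norm (velocity v s)" for s
    by (simp add: w_def v_def)
  have v: "Ck_on (Suc (Suc m)) v I" "\<And>s. s \<in> I \<Longrightarrow> norm (v s) = 1"
      "\<And>s. s \<in> I \<Longrightarrow> velocity v s \<noteq> 0"
    using Suc.IH[of "Suc m"] Suc.prems unfolding v_def by (simp_all del: Ck_on.simps psi_seq.simps)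
  have Cw: "Ck_on (Suc m) w I"
    unfolding w[abs_def] using v(1,3) by (intro Ck_on_normalize[OF I]) auto
  have dv: "(v has_vector_derivative velocity v s) (at s)"
    and dw: "(w has_vector_derivative velocity w s) (at s)" if "s \<in> I" for s
    using v(1) Cw that by (auto intro: has_vector_derivative_velocity[OF I])
  have "velocity w s \<noteq> 0" if "s \<in> I" for s
  proof -
    have "v t \<bullet> w t = 0" if "t \<in> I" for t
      using inner_velocity_unit_field[OF I v(2) that dv[OF that]] by (simp add: w)
    then have "velocity w s \<bullet> v s = - (velocity v s \<bullet> w s)"
      using inner_velocity_orthogonal_fields[OF I _ that dv dw] that by blast
    also have "velocity v s \<bullet> w s = norm (velocity v s)"
      using v(3)[OF that] by (simp add: w dot_square_norm power2_eq_square)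
    finally show ?thesis
      using v(3)[OF that] by auto
  qed
  moreover have "norm (w s) = 1" if "s \<in> I" for s
    using v(3)[OF that] by (simp add: w)
  ultimately show ?case
    using Cw unfolding w_def by blast
qed

lemma moving_frame_psi_seq:
  assumes I: "open I" "is_interval I" and C: "Ck_on (k + 3) \<psi> I" "arc_length_param_on \<psi> I"
    and \<kappa>: "\<And>s. s \<in> I \<Longrightarrow> curvature \<psi> s \<noteq> 0"
  shows "moving_frame I (psi_seq \<psi> (k + 1)) (psi_seq \<psi> (k + 2)) (velocity (psi_seq \<psi> (k + 2)))
    (\<lambda>s. norm (velocity (psi_seq \<psi> (k + 1)) s))"
proof -
  define v where "v = psi_seq \<psi> (k + 1)"
  define w where "w = psi_seq \<psi> (k + 2)"
  have w: "w s = velocity v s /\<^sub>R norm (velocity v s)" for s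
    by (simp add: w_def v_def)
  have v: "Ck_on 2 v I" "\<And>s. s \<in> I \<Longrightarrow> norm (v s) = 1" "\<And>s. s \<in> I \<Longrightarrow> velocity v s \<noteq> 0"
    using psi_seq_regular[OF I(1), of 1 k] C \<kappa> unfolding v_def
    by (simp_all add: numeral_2_eq_2 numeral_3_eq_3 del: Ck_on.simps psi_seq.simps)
  have "Ck_on (Suc 0) w I"
    unfolding w[abs_def] using v(1,3)
    by (intro Ck_on_normalize[OF I(1)]) (auto simp: numeral_2_eq_2)
  then have "w differentiable_on I" "continuous_on I (velocity w)"
    by auto
  moreover have "v differentiable_on I" "continuous_on I (velocity v)"
    using v(1) by (auto simp: numeral_2_eq_2 intro: differentiable_imp_continuous_on)
  ultimately have "moving_frame I v w (velocity w) (\<lambda>s. norm (velocity v s))"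
    using v(2,3) I has_vector_derivative_velocity[OF I(1)]
    by unfold_locales (auto simp: w intro: continuous_on_norm)
  then show ?thesis
    by (simp only: v_def w_def)
qed

theorem lemma5p4:
  fixes k :: nat and I :: "real set" and \<psi> :: "real \<Rightarrow> real^3"
  assumes "open I" and "is_interval I"
    and "Ck_on (k + 3) \<psi> I"
    and "arc_length_param_on \<psi> I"
    and "\<And>s. s \<in> I \<Longrightarrow> curvature \<psi> s \<noteq> 0"
    and "\<And>s. s \<in> I \<Longrightarrow> torsion \<psi> s \<noteq> 0"
  shows "k_slant_helix k \<psi> I \<longleftrightarrow> constant_angle_on (B_field \<psi> k) I"
proof -
  interpret moving_frame I "psi_seq \<psi> (k + 1)" "psi_seq \<psi> (k + 2)" "velocity (psi_seq \<psi> (k + 2))"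
    "\<lambda>s. norm (velocity (psi_seq \<psi> (k + 1)) s)"
    using assms(1-5) by (rule moving_frame_psi_seq)
  have "B_field \<psi> k s = b s" if "s \<in> I" for s
    using norm_b[OF that] by (simp only: B_field_def b_def) simp
  then have "constant_angle_on (B_field \<psi> k) I \<longleftrightarrow> constant_angle_on b I"
    by (simp add: constant_angle_on_def constant_on_def)
  then show ?thesis
    using constant_angle_v_imp_b constant_angle_b_imp_v by (auto simp only: k_slant_helix_def)
qed

end
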